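(* Consider the system $\dot x=f(x)+B(x)u$ with its differential dynamics $\delta\dot x=A(x,u)\delta x+B(x)\delta u$, and suppose that (for a forward invariant target dynamics $\dot x_d=f(x_d)+B(x_d)u_d$) there exists a symmetric metric $\underline pI\le M(x)\le\bar pI$, $\underline p,\bar p>0$, satisfying, for some $\lambda>0$: for any non-zero $v\in\mathbb{R}^n$, $$v^\top M(x)B(x)=0\quad\Longrightarrow\quad v^\top\Big[\partial_fM(x)+2M(x)\frac{\partial f(x)}{\partial x}\Big]v\le-\lambda v^\top M(x)v,$$ and for $i=1,\dots,m$ $$\partial_{B_i}M(x)+\frac{\partial B_i(x)}{\partial x}^\top M(x)+M(x)\frac{\partial B_i(x)}{\partial x}=0.$$ Then there exists a globally defined smooth function $\gamma:\mathbb{R}^n\to\mathbb{R}_{\ge0}$ such that the differential feedback controller $$\delta u=-\gamma(x)\mathcal{R}(x)\delta y+\delta v,$$ with damping matrix $\mathcal{R}(x):=[(M(x)B(x))^\top M(x)B(x)]^{-1}$ and differential output $\delta y=[M(x)B(x)]^\top\delta x$, makes the system differentially passive with the input-output pair $(\delta v,\delta y)$. Furthermore, the damping injection $\delta v=-\gamma_0\delta y$ with $\gamma_0>0$ makes the origin of the differential dynamics asymptotically stable, and $\delta v=-\gamma_0\mathcal{R}(x)\delta y$ makes the origin exponentially stable.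
   Context: All mappings are smooth. State $x\in\mathbb{R}^n$, input $u\in\mathbb{R}^m$, $n>m$; $B(x)\in\mathbb{R}^{n\times m}$ has full rank, with columns $B_1,\dots,B_m$. For a matrix function $M(x)$ and a vector field $f$, $\partial_fM(x)=\sum_i\frac{\partial M(x)}{\partial x_i}f_i(x)$. The differential dynamics along a solution $x(t)$ with input $u(t)$ is $\delta\dot x=A(x,u)\delta x+B(x)\delta u$, where $A(x,u):=\frac{\partial f(x)}{\partial x}+\frac{\partial (B(x)u)}{\partial x}$ ($u$ held fixed in the derivative). Differential passivity with input-output pair $(\delta v,\delta y)$: there is a nonnegative differential storage function $V(x,\delta x)$ (here $V(x,\delta x)=\frac12\delta x^\top M(x)\delta x$) such that $\frac{d}{dt}V(x,\delta x)\le\delta v^\top\delta y$ along the solutions of the system together with its differential dynamics. *)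

theory Defs
  imports "HOL-Analysis.Analysis"
begin

text \<open>Smooth means of class \<open>C\<^sup>\<infinity>\<close>: the map and all its iterated directional derivatives are
  differentiable everywhere. On a finite-dimensional domain this is the usual notion.\<close>

primrec Ck :: "nat \<Rightarrow> ('a::real_normed_vector \<Rightarrow> 'b::real_normed_vector) \<Rightarrow> bool" where
  "Ck 0 g \<longleftrightarrow> continuous_on UNIV g"
| "Ck (Suc k) g \<longleftrightarrow> (\<forall>x. g differentiable (at x)) \<and>
     (\<forall>w. Ck k (\<lambda>x. frechet_derivative g (at x) w))"

definition smooth :: "('a::real_normed_vector \<Rightarrow> 'b::real_normed_vector) \<Rightarrow> bool" where
  "smooth g \<longleftrightarrow> (\<forall>k. Ck k g)"

definition loewner_le :: "real^'n^'n \<Rightarrow> real^'n^'n \<Rightarrow> bool" (infix "\<preceq>" 50) where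
  "P \<preceq> Q \<longleftrightarrow> (\<forall>v. v \<bullet> (P *v v) \<le> v \<bullet> (Q *v v))"

definition partial_deriv :: "'n::finite \<Rightarrow> (real^'n \<Rightarrow> 'b::real_normed_vector) \<Rightarrow> real^'n \<Rightarrow> 'b" where
  "partial_deriv i g x = frechet_derivative g (at x) (axis i 1)"

definition deriv_along :: "(real^'n::finite \<Rightarrow> real^'n) \<Rightarrow> (real^'n \<Rightarrow> 'b::real_normed_vector) \<Rightarrow> real^'n \<Rightarrow> 'b" where
  "deriv_along g M x = (\<Sum>i\<in>UNIV. g x $ i *\<^sub>R partial_deriv i M x)"

definition A_matrix ::
    "(real^'n::finite \<Rightarrow> real^'n) \<Rightarrow> (real^'n \<Rightarrow> real^'m::finite^'n) \<Rightarrow> real^'n \<Rightarrow> real^'m \<Rightarrow> real^'n^'n" where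
  "A_matrix f B x u = jacobian f (at x) + jacobian (\<lambda>z. B z *v u) (at x)"

definition system_solution ::
    "(real^'n::finite \<Rightarrow> real^'n) \<Rightarrow> (real^'n \<Rightarrow> real^'m::finite^'n) \<Rightarrow>
     (real \<Rightarrow> real^'m) \<Rightarrow> (real \<Rightarrow> real^'n) \<Rightarrow> real set \<Rightarrow> bool" where
  "system_solution f B u x J \<longleftrightarrow>
     (\<forall>t\<in>J. (x has_vector_derivative (f (x t) + B (x t) *v u t)) (at t within J))"

definition diff_dynamics ::
    "(real^'n::finite \<Rightarrow> real^'n) \<Rightarrow> (real^'n \<Rightarrow> real^'m::finite^'n) \<Rightarrow>
     real^'n \<Rightarrow> real^'m \<Rightarrow> real^'n \<Rightarrow> real^'m \<Rightarrow> real^'n" where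
  "diff_dynamics f B x u dx du = A_matrix f B x u *v dx + B x *v du"

definition diff_output ::
    "(real^'n::finite \<Rightarrow> real^'n^'n) \<Rightarrow> (real^'n \<Rightarrow> real^'m::finite^'n) \<Rightarrow> real^'n \<Rightarrow> real^'n \<Rightarrow> real^'m" where
  "diff_output M B x dx = transpose (M x ** B x) *v dx"

definition damping_matrix ::
    "(real^'n::finite \<Rightarrow> real^'n^'n) \<Rightarrow> (real^'n \<Rightarrow> real^'m::finite^'n) \<Rightarrow> real^'n \<Rightarrow> real^'m^'m" where
  "damping_matrix M B x = matrix_inv (transpose (M x ** B x) ** (M x ** B x))"

definition diff_feedback ::
    "(real^'n::finite \<Rightarrow> real) \<Rightarrow> (real^'n \<Rightarrow> real^'n^'n) \<Rightarrow> (real^'n \<Rightarrow> real^'m::finite^'n) \<Rightarrow>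
     real^'n \<Rightarrow> real^'n \<Rightarrow> real^'m \<Rightarrow> real^'m" where
  "diff_feedback \<gamma> M B x dx dv = - (\<gamma> x *\<^sub>R (damping_matrix M B x *v diff_output M B x dx)) + dv"

text \<open>Below, the differential input is given by a feedback \<open>K\<close>, that is \<open>du = K x dx dv\<close> with new
  input \<open>dv\<close>, and \<open>h x dx\<close> is the differential output. The system together with its
  differential dynamics is considered along every trajectory \<open>(x, u)\<close>, including those with finite
  escape time.\<close>

definition differentially_passive_with_storage ::
    "(real^'n::finite \<Rightarrow> real^'n \<Rightarrow> real) \<Rightarrow>
     (real^'n \<Rightarrow> real^'n) \<Rightarrow> (real^'n \<Rightarrow> real^'m::finite^'n) \<Rightarrow>
     (real^'n \<Rightarrow> real^'n \<Rightarrow> real^'m \<Rightarrow> real^'m) \<Rightarrow> (real^'n \<Rightarrow> real^'n \<Rightarrow> real^'m) \<Rightarrow> bool" where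
  "differentially_passive_with_storage V f B K h \<longleftrightarrow>
     (\<forall>x dx. 0 \<le> V x dx) \<and>
     (\<forall>T>0. \<forall>x u dx dv.
        system_solution f B u x {0..<T} \<longrightarrow>
        (\<forall>t\<in>{0..<T}. (dx has_vector_derivative
            diff_dynamics f B (x t) (u t) (dx t) (K (x t) (dx t) (dv t))) (at t within {0..<T})) \<longrightarrow>
        (\<forall>t\<in>{0..<T}. \<exists>d. ((\<lambda>s. V (x s) (dx s)) has_real_derivative d) (at t within {0..<T}) \<and>
            d \<le> dv t \<bullet> h (x t) (dx t)))"

text \<open>Stability of the origin of the non-autonomous system \<open>z' = F t z\<close>, \<open>t \<ge> 0\<close>,
  with the usual textbook definitions.\<close>

definition solution_from :: "(real \<Rightarrow> 'a::real_normed_vector \<Rightarrow> 'a) \<Rightarrow> real \<Rightarrow> (real \<Rightarrow> 'a) \<Rightarrow> bool" where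
  "solution_from F t0 z \<longleftrightarrow>
     (\<forall>t\<ge>t0. (z has_vector_derivative F t (z t)) (at t within {t0..}))"

definition origin_stable :: "(real \<Rightarrow> 'a::real_normed_vector \<Rightarrow> 'a) \<Rightarrow> bool" where
  "origin_stable F \<longleftrightarrow>
     (\<forall>t\<ge>0. F t 0 = 0) \<and>
     (\<forall>t0\<ge>0. \<forall>\<epsilon>>0. \<exists>\<delta>>0. \<forall>z. solution_from F t0 z \<and> norm (z t0) < \<delta> \<longrightarrow>
        (\<forall>t\<ge>t0. norm (z t) < \<epsilon>))"

definition origin_asymptotically_stable :: "(real \<Rightarrow> 'a::real_normed_vector \<Rightarrow> 'a) \<Rightarrow> bool" where
  "origin_asymptotically_stable F \<longleftrightarrow> origin_stable F \<and>
     (\<forall>t0\<ge>0. \<exists>c>0. \<forall>z. solution_from F t0 z \<and> norm (z t0) < c \<longrightarrow> (z \<longlongrightarrow> 0) at_top)"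

definition origin_exponentially_stable :: "(real \<Rightarrow> 'a::real_normed_vector \<Rightarrow> 'a) \<Rightarrow> bool" where
  "origin_exponentially_stable F \<longleftrightarrow>
     (\<forall>t\<ge>0. F t 0 = 0) \<and>
     (\<exists>c>0. \<exists>k>0. \<exists>\<alpha>>0. \<forall>t0\<ge>0. \<forall>z. solution_from F t0 z \<and> norm (z t0) < c \<longrightarrow>
        (\<forall>t\<ge>t0. norm (z t) \<le> k * norm (z t0) * exp (- \<alpha> * (t - t0))))"

end

theory Submission
  imports Defs
begin

text \<open>Along trajectories, the Killing condition on the columns of \<open>B\<close> cancels every term of
  \<open>d/dt (dx \<bullet> M dx)\<close> that contains \<open>u\<close>, leaving \<open>dx \<bullet> W dx + 2 (y \<bullet> du)\<close> with
  \<open>W = deriv_along f M + 2 M (jacobian f)\<close> and \<open>y = (M B)\<^sup>T dx\<close>. Since \<open>y \<bullet> R y\<close> is the squared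
  norm of the orthogonal projection of \<open>dx\<close> onto the range of \<open>M B\<close>, and \<open>W\<close> is uniformly negative on
  the orthogonal complement of that range, subtracting \<open>2 \<gamma> (y \<bullet> R y)\<close> with \<open>\<gamma>\<close> a suitable
  affine function of \<open>(norm W)\<^sup>2\<close> makes the form at most \<open>- \<mu> (norm dx)\<^sup>2\<close>. No partition of unity is needed:
  this \<open>\<gamma>\<close> is smooth and nonnegative. The uniform bounds on \<open>M\<close> then give exponential decay.\<close>

section \<open>Calculus of smooth maps\<close>

text \<open>Differentiability supplies continuity at the bottom level, and the induction passes
  through directional derivatives. The product rule needs this lowering because it leaves one factor
  undifferentiated.\<close>

lemma Ck_Suc_imp_Ck: "Ck (Suc k) g \<Longrightarrow> Ck k g"
proof (induction k arbitrary: g)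
  case 0
  then show ?case
    by (auto intro!: differentiable_imp_continuous_on simp: differentiable_on_def differentiable_at_withinI)
next
  case (Suc k)
  have "Ck k (\<lambda>x. frechet_derivative g (at x) w)" for w
    using Suc.prems by (intro Suc.IH) simp
  then show ?case
    using Suc.prems by simp
qed

lemma Ck_const: "Ck k (\<lambda>x. c)"
  by (induction k arbitrary: c) (simp_all add: frechet_derivative_const)

lemma Ck_add:
  assumes "Ck k g" "Ck k h"
  shows "Ck k (\<lambda>x. g x + h x)"
  using assms
proof (induction k arbitrary: g h)
  case 0
  then show ?case by (simp add: continuous_on_add)
next
  case (Suc k)
  have "frechet_derivative (\<lambda>x. g x + h x) (at x) =
      (\<lambda>w. frechet_derivative g (at x) w + frechet_derivative h (at x) w)" for x
    using Suc.prems
    by (intro frechet_derivative_at[symmetric] has_derivative_add)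
      (simp_all add: frechet_derivative_works[symmetric])
  then show ?case
    using Suc by simp
qed

lemma (in bounded_linear) Ck: "Ck k g \<Longrightarrow> Ck k (\<lambda>x. f (g x))"
proof (induction k arbitrary: g)
  case 0
  then show ?case by (simp add: continuous_on)
next
  case (Suc k)
  have "frechet_derivative (\<lambda>x. f (g x)) (at x) = (\<lambda>w. f (frechet_derivative g (at x) w))" for x
    using Suc.prems
    by (intro frechet_derivative_at[symmetric] has_derivative)
      (simp_all add: frechet_derivative_works[symmetric])
  moreover have "(\<lambda>x. f (g x)) differentiable (at x)" for x
    using Suc.prems by (metis Ck.simps(2) differentiable_def has_derivative)
  ultimately show ?case
    using Suc by simp
qed

text \<open>By the Leibniz rule each directional derivative is a sum of two products of the same
  kind, so induction with both factors arbitrary suffices. One proof serves scalar, matrix and inner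
  products.\<close>

lemma (in bounded_bilinear) Ck:
  assumes "Ck k g" "Ck k h"
  shows "Ck k (\<lambda>x. prod (g x) (h x))"
  using assms
proof (induction k arbitrary: g h)
  case 0
  then show ?case by (simp add: continuous_on)
next
  case (Suc k)
  have D: "((\<lambda>x. prod (g x) (h x)) has_derivative
      (\<lambda>w. prod (g x) (frechet_derivative h (at x) w) + prod (frechet_derivative g (at x) w) (h x))) (at x)"
    for x
    using Suc.prems by (intro FDERIV) (simp_all add: frechet_derivative_works[symmetric])
  have "Ck k g" "Ck k h"
    using Suc.prems Ck_Suc_imp_Ck by blast+
  then have "Ck k (\<lambda>x. prod (g x) (frechet_derivative h (at x) w) + prod (frechet_derivative g (at x) w) (h x))"
    for w
    using Suc.prems by (intro Ck_add Suc.IH) simp_all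
  then show ?case
    using D by (auto simp: frechet_derivative_at[OF D, symmetric] differentiable_def)
qed

lemma smooth_const: "smooth (\<lambda>x. c)"
  by (simp add: smooth_def Ck_const)

lemma smooth_add: "smooth g \<Longrightarrow> smooth h \<Longrightarrow> smooth (\<lambda>x. g x + h x)"
  by (simp add: smooth_def Ck_add)

lemma smooth_sum:
  "(\<And>i. i \<in> I \<Longrightarrow> smooth (g i)) \<Longrightarrow> smooth (\<lambda>x. \<Sum>i\<in>I. g i x)"
  by (induction I rule: infinite_finite_induct) (auto intro: smooth_const smooth_add)

lemma (in bounded_linear) smooth: "smooth g \<Longrightarrow> smooth (\<lambda>x. f (g x))"
  by (simp add: smooth_def Ck)

lemma (in bounded_bilinear) smooth: "smooth g \<Longrightarrow> smooth h \<Longrightarrow> smooth (\<lambda>x. prod (g x) (h x))"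
  by (simp add: smooth_def Ck)

lemma smooth_frechet_derivative: "smooth g \<Longrightarrow> smooth (\<lambda>x. frechet_derivative g (at x) w)"
  unfolding smooth_def by (metis Ck.simps(2))

lemma smooth_imp_has_derivative: "smooth g \<Longrightarrow> (g has_derivative frechet_derivative g (at x)) (at x)"
  unfolding smooth_def by (metis Ck.simps(2) frechet_derivative_works)

section \<open>Matrix-valued maps and their derivatives\<close>

lemma bounded_bilinear_matrix_matrix_mult:
  "bounded_bilinear ((**) :: real^'n^'m \<Rightarrow> real^'p^'n \<Rightarrow> real^'p^'m)"
  unfolding bilinear_conv_bounded_bilinear[symmetric] bilinear_def
  by (auto intro!: linearI simp: matrix_matrix_mult_def vec_eq_iff sum.distrib sum_distrib_left
      algebra_simps)

lemma bounded_bilinear_matrix_vector_mult: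
  "bounded_bilinear ((*v) :: real^'n^'m \<Rightarrow> real^'n \<Rightarrow> real^'m)"
  unfolding bilinear_conv_bounded_bilinear[symmetric] bilinear_def
  by (auto intro!: linearI simp: matrix_vector_mult_def vec_eq_iff sum.distrib sum_distrib_left
      algebra_simps)

lemma smooth_jacobian:
  fixes g :: "real^'n \<Rightarrow> real^'m"
  assumes "smooth g"
  shows "smooth (\<lambda>x. jacobian g (at x))"
proof -
  \<comment> \<open>\<open>L j\<close> places a vector in column \<open>j\<close> of a zero matrix,
    so the Jacobian becomes a finite sum of fixed linear images of directional derivatives.\<close>
  define L :: "'n \<Rightarrow> real^'m \<Rightarrow> real^'n^'m" where "L j v = (\<chi> i k. if k = j then v $ i else 0)" for j v
  have "linear (L j)" for j
    by (auto intro!: linearI simp: L_def vec_eq_iff)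
  then have "bounded_linear (L j)" for j
    by (simp add: linear_conv_bounded_linear)
  moreover have "jacobian g (at x) = (\<Sum>j\<in>UNIV. L j (frechet_derivative g (at x) (axis j 1)))" for x
    by (simp add: L_def vec_eq_iff jacobian_def matrix_def)
  ultimately show ?thesis
    by (auto intro!: smooth_sum intro: bounded_linear.smooth[OF _ smooth_frechet_derivative] assms)
qed

lemma smooth_deriv_along:
  fixes g :: "real^'n \<Rightarrow> real^'n"
  assumes "smooth g" "smooth P"
  shows "smooth (deriv_along g P)"
  unfolding deriv_along_def[abs_def] partial_deriv_def
  by (intro smooth_sum bounded_bilinear.smooth[OF bounded_bilinear_scaleR]
      bounded_linear.smooth[OF bounded_linear_vec_nth] smooth_frechet_derivative assms)

text \<open>Linearity of the derivative in its direction collapses the coordinate sum. The chain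
  rule along a trajectory produces the right-hand form.\<close>

lemma deriv_along_eq_frechet_derivative:
  assumes "smooth P"
  shows "deriv_along g P x = frechet_derivative P (at x) (g x)"
proof -
  interpret linear "frechet_derivative P (at x)"
    using smooth_imp_has_derivative[OF assms] by (rule has_derivative_linear)
  have "frechet_derivative P (at x) (g x) = frechet_derivative P (at x) (\<Sum>i\<in>UNIV. g x $ i *\<^sub>R axis i 1)"
    using basis_expansion[of "g x"] by (simp add: scalar_mult_eq_scaleR)
  then show ?thesis
    by (simp add: sum scaleR deriv_along_def partial_deriv_def)
qed

lemma jacobian_mult_vector:
  fixes g :: "real^'n \<Rightarrow> real^'m"
  assumes "smooth g"
  shows "jacobian g (at x) *v w = frechet_derivative g (at x) w"
  unfolding jacobian_def
  by (rule matrix_vector_mul(2)[OF has_derivative_linear[OF smooth_imp_has_derivative[OF assms]],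
        THEN fun_cong])

section \<open>Linear algebra\<close>

lemma mat_vector_mult: "mat c *v v = c *\<^sub>R (v :: real^'n)"
  by (simp add: mat_def matrix_vector_mult_def vec_eq_iff if_distrib if_distribR cong: if_cong)

text \<open>Cauchy-Schwarz in each row. The norm of a matrix is here the Frobenius norm, whose
  square is polynomial in the entries; this later keeps the gain smooth.\<close>

lemma norm_matrix_vector_mult_le:
  fixes A :: "real^'n^'m"
  shows "norm (A *v v) \<le> norm A * norm v"
proof -
  have "norm (A *v v) = L2_set (\<lambda>i. A $ i \<bullet> v) UNIV"
    by (simp add: norm_vec_def[of "A *v v"] matrix_vector_mul_component L2_set_def)
  also have "\<dots> \<le> L2_set (\<lambda>i. norm (A $ i) * norm v) UNIV"
  proof -
    have "L2_set (\<lambda>i. \<bar>A $ i \<bullet> v\<bar>) UNIV \<le> L2_set (\<lambda>i. norm (A $ i) * norm v) UNIV"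
      by (intro L2_set_mono Cauchy_Schwarz_ineq2) simp
    then show ?thesis by (simp add: L2_set_def)
  qed
  also have "\<dots> = norm A * norm v"
    by (simp add: norm_vec_def[of A] L2_set_left_distrib)
  finally show ?thesis .
qed

lemma inner_matrix_vector_mult_le:
  fixes A :: "real^'n^'n"
  shows "v \<bullet> (A *v w) \<le> norm A * norm v * norm w"
proof -
  have "v \<bullet> (A *v w) \<le> norm v * norm (A *v w)"
    by (rule norm_cauchy_schwarz)
  also have "\<dots> \<le> norm v * (norm A * norm w)"
    by (intro mult_left_mono norm_matrix_vector_mult_le) simp
  finally show ?thesis by (simp add: algebra_simps)
qed

text \<open>\<open>b\<close> is the orthogonal projection of \<open>v\<close> onto the range of
  \<open>N\<close>, and \<open>a\<close> lies in the kernel of \<open>transpose N\<close>.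
  Injectivity of \<open>N\<close> makes the Gram matrix invertible.\<close>

lemma orthogonal_split_range:
  fixes N :: "real^'m^'n"
  assumes inj: "\<And>w. N *v w = 0 \<Longrightarrow> w = 0"
  defines "R \<equiv> matrix_inv (transpose N ** N)"
  obtains a b where "v = a + b" "a v* N = 0" "a \<bullet> b = 0"
    "(norm b)\<^sup>2 = (v v* N) \<bullet> (R *v (v v* N))"
proof -
  have "w = 0" if "(transpose N ** N) *v w = 0" for w
  proof -
    have "(N *v w) \<bullet> (N *v w) = w \<bullet> ((transpose N ** N) *v w)"
      by (metis dot_lmul_matrix matrix_vector_mul_assoc inner_commute transpose_matrix_vector)
    then show ?thesis using that inj by simp
  qed
  then have "invertible (transpose N ** N)"
    using invertible_left_inverse matrix_left_invertible_ker by blast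
  then have R: "(transpose N ** N) ** R = mat 1"
    unfolding R_def matrix_inv_def invertible_def by (rule someI2_ex) simp
  define b where "b = N *v (R *v (v v* N))"
  define a where "a = v - b"
  have bN: "b v* N = v v* N"
  proof -
    have "b v* N = ((transpose N ** N) ** R) *v (v v* N)"
      by (simp add: b_def matrix_vector_mul_assoc[symmetric])
    then show ?thesis by (simp add: R)
  qed
  show thesis
  proof
    show "v = a + b" by (simp add: a_def)
    show aN: "a v* N = 0" by (simp add: a_def bN algebra_simps)
    show "a \<bullet> b = 0" by (metis aN b_def dot_lmul_matrix inner_zero_left)
    show "(norm b)\<^sup>2 = (v v* N) \<bullet> (R *v (v v* N))"
      by (metis b_def bN dot_lmul_matrix power2_norm_eq_inner)
  qed
qed

text \<open>A quantitative form of Finsler's lemma: the penalty weight is affine in \<open>(norm W)\<^sup>2\<close>,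
  which makes it smooth when \<open>W\<close> varies smoothly with a parameter.\<close>

lemma quadratic_form_penalty:
  fixes W :: "real^'n^'n"
  assumes "\<mu> > 0" "a \<bullet> b = 0" "a \<bullet> (W *v a) \<le> - 2 * \<mu> * (norm a)\<^sup>2"
  shows "(a + b) \<bullet> (W *v (a + b)) \<le>
    - \<mu> * (norm (a + b))\<^sup>2 + ((norm W)\<^sup>2 * (1 / \<mu> + 1) + 1 + \<mu>) * (norm b)\<^sup>2"
proof -
  \<comment> \<open>Young's inequality from a completed square: of the available decay
    \<open>2 * \<mu>\<close> in the direction \<open>a\<close>, one \<open>\<mu>\<close> pays for
    the two cross terms.\<close>
  have "2 * (norm W * norm a * norm b) \<le> \<mu> * (norm a)\<^sup>2 + (norm W)\<^sup>2 * (norm b)\<^sup>2 / \<mu>"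
  proof -
    have "0 \<le> (\<mu> * norm a - norm W * norm b)\<^sup>2 / \<mu>" using assms by simp
    also have "\<dots> = \<mu> * (norm a)\<^sup>2 + (norm W)\<^sup>2 * (norm b)\<^sup>2 / \<mu> - 2 * (norm W * norm a * norm b)"
      using assms by (simp add: field_simps power2_eq_square)
    finally show ?thesis by simp
  qed
  \<comment> \<open>The norm is traded for its square because the norm itself is not smooth at
    zero.\<close>
  moreover have "norm W * norm b * norm b \<le> ((norm W)\<^sup>2 + 1) * (norm b)\<^sup>2"
  proof -
    have "2 * norm W \<le> (norm W)\<^sup>2 + 1"
      using zero_le_power2[of "norm W - 1"] by (simp add: power2_diff)
    then have "norm W \<le> (norm W)\<^sup>2 + 1"
      using norm_ge_zero[of W] by linarith
    then have "norm W * (norm b)\<^sup>2 \<le> ((norm W)\<^sup>2 + 1) * (norm b)\<^sup>2"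
      by (rule mult_right_mono) simp
    then show ?thesis by (simp add: power2_eq_square mult.assoc)
  qed
  moreover have "(norm (a + b))\<^sup>2 = (norm a)\<^sup>2 + (norm b)\<^sup>2"
    using assms(2) by (simp add: norm_add_Pythagorean orthogonal_def)
  moreover have "(a + b) \<bullet> (W *v (a + b)) =
      a \<bullet> (W *v a) + a \<bullet> (W *v b) + b \<bullet> (W *v a) + b \<bullet> (W *v b)"
    by (simp add: inner_add_left inner_add_right matrix_vector_right_distrib)
  moreover have "a \<bullet> (W *v b) \<le> norm W * norm a * norm b" "b \<bullet> (W *v a) \<le> norm W * norm a * norm b"
    "b \<bullet> (W *v b) \<le> norm W * norm b * norm b"
    using inner_matrix_vector_mult_le[of a W b] inner_matrix_vector_mult_le[of b W a]
      inner_matrix_vector_mult_le[of b W b] by (simp_all add: algebra_simps)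
  ultimately show ?thesis
    using assms by (simp add: algebra_simps)
qed

section \<open>Exponential decay and stability\<close>

text \<open>Differential form of Gronwall's inequality: multiplied by
  \<open>exp (\<alpha> * (s - t0))\<close>, \<open>v\<close> has a nonpositive derivative.\<close>

lemma exponential_decay:
  fixes v :: "real \<Rightarrow> real"
  assumes deriv: "\<And>s. s \<ge> t0 \<Longrightarrow>
      \<exists>d. (v has_real_derivative d) (at s within {t0..}) \<and> d \<le> - \<alpha> * v s"
    and "t \<ge> t0"
  shows "v t \<le> v t0 * exp (- \<alpha> * (t - t0))"
proof -
  let ?w = "\<lambda>s. v s * exp (\<alpha> * (s - t0))"
  have D: "\<exists>d. (?w has_real_derivative d) (at s within {t0..}) \<and> d \<le> 0" if s: "s \<ge> t0" for s
  proof -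
    obtain d where d: "(v has_real_derivative d) (at s within {t0..})" "d \<le> - \<alpha> * v s"
      using deriv[OF s] by blast
    have "(?w has_real_derivative (d + \<alpha> * v s) * exp (\<alpha> * (s - t0))) (at s within {t0..})"
      by (auto intro!: derivative_eq_intros d(1) simp: algebra_simps)
    moreover have "(d + \<alpha> * v s) * exp (\<alpha> * (s - t0)) \<le> 0"
      using d(2) by (intro mult_nonpos_nonneg) auto
    ultimately show ?thesis by blast
  qed
  have "?w t \<le> ?w t0"
  proof (rule DERIV_nonpos_imp_decreasing_open[OF \<open>t \<ge> t0\<close>])
    fix s assume s: "t0 < s" "s < t"
    \<comment> \<open>The derivative is two-sided only beyond \<open>t0\<close>; at the endpoint
      continuity suffices for the monotonicity theorem.\<close>
    then have "at s within {t0..} = at s"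
      by (intro at_within_interior) simp
    then show "\<exists>d. DERIV ?w s :> d \<and> d \<le> 0"
      using D[of s] s by simp
  next
    have "continuous (at s within {t0..}) ?w" if "s \<ge> t0" for s
      using D[OF that] DERIV_continuous by blast
    then have "continuous_on {t0..} ?w"
      by (simp add: continuous_on_eq_continuous_within)
    then show "continuous_on {t0..t} ?w"
      by (rule continuous_on_subset) auto
  qed
  then have "v t * (exp (\<alpha> * (t - t0)) * exp (- \<alpha> * (t - t0))) \<le> v t0 * exp (- \<alpha> * (t - t0))"
    by (simp add: mult.assoc[symmetric])
  then show ?thesis
    by (simp add: exp_add[symmetric])
qed

text \<open>The bound holds for every initial value, so any radius of attraction works and 1 is
  taken; \<open>\<epsilon> / k\<close> is the radius for stability.\<close>

lemma stable_of_exponential_bound: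
  fixes F :: "real \<Rightarrow> 'a::real_normed_vector \<Rightarrow> 'a"
  assumes "\<And>t. F t 0 = 0" "k > 0" "\<alpha> > 0"
    and bound: "\<And>t0 z t. t0 \<ge> 0 \<Longrightarrow> solution_from F t0 z \<Longrightarrow> t \<ge> t0 \<Longrightarrow>
      norm (z t) \<le> k * norm (z t0) * exp (- \<alpha> * (t - t0))"
  shows "origin_exponentially_stable F" "origin_asymptotically_stable F"
proof -
  show "origin_exponentially_stable F"
    unfolding origin_exponentially_stable_def
    using assms zero_less_one by blast
  have "norm (z t) < \<epsilon>"
    if "t0 \<ge> 0" "solution_from F t0 z" "norm (z t0) < \<epsilon> / k" "t \<ge> t0" for t0 z t \<epsilon>
  proof -
    have "norm (z t) \<le> k * norm (z t0) * exp (- \<alpha> * (t - t0))"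
      using bound that by blast
    also have "\<dots> \<le> k * norm (z t0) * 1"
      using \<open>k > 0\<close> \<open>\<alpha> > 0\<close> \<open>t \<ge> t0\<close> by (intro mult_left_mono) auto
    also have "\<dots> < \<epsilon>"
      using that \<open>k > 0\<close> by (simp add: field_simps)
    finally show ?thesis .
  qed
  then have "\<exists>\<delta>>0. \<forall>z. solution_from F t0 z \<and> norm (z t0) < \<delta> \<longrightarrow> (\<forall>t\<ge>t0. norm (z t) < \<epsilon>)"
    if "t0 \<ge> 0" "\<epsilon> > 0" for t0 \<epsilon>
    using that \<open>k > 0\<close> by (intro exI[of _ "\<epsilon> / k"]) auto
  then have "origin_stable F"
    unfolding origin_stable_def using assms(1) by blast
  moreover have "(z \<longlongrightarrow> 0) at_top" if "t0 \<ge> 0" "solution_from F t0 z" for t0 z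
  proof (rule Lim_null_comparison)
    show "\<forall>\<^sub>F t in at_top. norm (z t) \<le> k * norm (z t0) * exp (- \<alpha> * (t - t0))"
      using eventually_ge_at_top[of t0] by eventually_elim (rule bound[OF that])
    have "filterlim (\<lambda>t. - \<alpha> * (t - t0)) at_bot at_top"
      using filterlim_tendsto_neg_mult_at_bot[OF tendsto_const _
          filterlim_tendsto_add_at_top[OF tendsto_const filterlim_ident], of "- \<alpha>" "- t0"] \<open>\<alpha> > 0\<close>
      by simp
    then have "((\<lambda>t. exp (- \<alpha> * (t - t0))) \<longlongrightarrow> 0) at_top"
      by (rule filterlim_compose[OF exp_at_bot])
    then show "((\<lambda>t. k * norm (z t0) * exp (- \<alpha> * (t - t0))) \<longlongrightarrow> 0) at_top"
      by (rule tendsto_mult_right_zero)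
  qed
  ultimately show "origin_asymptotically_stable F"
    unfolding origin_asymptotically_stable_def using zero_less_one by blast
qed

section \<open>Control contraction metrics\<close>

text \<open>\<open>contraction\<close> concerns only directions orthogonal to the range of
  \<open>M x ** B x\<close>, and \<open>killing\<close> says that each column of \<open>B\<close> is
  a Killing field of the metric \<open>M\<close>.\<close>

locale control_contraction_metric =
  fixes f :: "real^'n::finite \<Rightarrow> real^'n"
    and B :: "real^'n \<Rightarrow> real^'m::finite^'n"
    and M :: "real^'n \<Rightarrow> real^'n^'n"
    and p_low p_up lam :: real
  assumes smooth_f: "smooth f" and smooth_B: "smooth B" and smooth_M: "smooth M"
    and rank_B: "\<And>x. rank (B x) = CARD('m)"
    and p_low: "p_low > 0" and p_up: "p_up > 0" and lam: "lam > 0"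
    and symmetric_M: "\<And>x. transpose (M x) = M x"
    and lower_bound: "\<And>x. mat p_low \<preceq> M x" and upper_bound: "\<And>x. M x \<preceq> mat p_up"
    and contraction: "\<And>x v. v \<noteq> 0 \<Longrightarrow> v v* (M x ** B x) = 0 \<Longrightarrow>
      v \<bullet> ((deriv_along f M x + 2 *\<^sub>R (M x ** jacobian f (at x))) *v v) \<le> - lam * (v \<bullet> (M x *v v))"
    and killing: "\<And>x i. deriv_along (\<lambda>z. column i (B z)) M x
      + transpose (jacobian (\<lambda>z. column i (B z)) (at x)) ** M x
      + M x ** jacobian (\<lambda>z. column i (B z)) (at x) = 0"
begin

definition W :: "real^'n \<Rightarrow> real^'n^'n" where
  "W x = deriv_along f M x + 2 *\<^sub>R (M x ** jacobian f (at x))"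

text \<open>Half of the margin: \<open>contraction\<close> and the lower bound on \<open>M\<close>
  give decay \<open>lam * p_low = 2 * \<mu>\<close> on the orthogonal complement, of which half is
  spent on cross terms.\<close>

definition \<mu> :: real where
  "\<mu> = lam * p_low / 2"

text \<open>Half the weight in \<open>quadratic_form_penalty\<close>, since the feedback enters the
  derivative of \<open>dx \<bullet> M dx\<close> with a factor 2.\<close>

definition \<gamma> :: "real^'n \<Rightarrow> real" where
  "\<gamma> x = ((norm (W x))\<^sup>2 * (1 / \<mu> + 1) + 1 + \<mu>) / 2"

abbreviation y where
  "y \<equiv> diff_output M B"

lemma \<mu>_pos: "\<mu> > 0"
  using lam p_low by (simp add: \<mu>_def)

lemma \<gamma>_nonneg: "0 \<le> \<gamma> x"
  using \<mu>_pos by (simp add: \<gamma>_def)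

lemma smooth_\<gamma>: "smooth \<gamma>"
proof -
  have "smooth W"
    unfolding W_def[abs_def]
    by (intro smooth_add smooth_deriv_along smooth_jacobian smooth_f smooth_M
        bounded_linear.smooth[OF bounded_linear_scaleR_right]
        bounded_bilinear.smooth[OF bounded_bilinear_matrix_matrix_mult])
  then have "smooth (\<lambda>x. W x \<bullet> W x)"
    by (intro bounded_bilinear.smooth[OF bounded_bilinear_inner])
  then have "smooth (\<lambda>x. (W x \<bullet> W x) * ((1 / \<mu> + 1) / 2) + (1 + \<mu>) / 2)"
    by (intro smooth_add smooth_const bounded_linear.smooth[OF bounded_linear_mult_left])
  moreover have "\<gamma> = (\<lambda>x. (W x \<bullet> W x) * ((1 / \<mu> + 1) / 2) + (1 + \<mu>) / 2)"
    by (auto simp: \<gamma>_def power2_norm_eq_inner add_divide_distrib)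
  ultimately show ?thesis
    by simp
qed

section \<open>Metric bounds and the dissipation inequality\<close>

lemma inner_M_lower: "p_low * (norm v)\<^sup>2 \<le> v \<bullet> (M x *v v)"
  using lower_bound[of x] by (simp add: loewner_le_def mat_vector_mult power2_norm_eq_inner)

lemma inner_M_upper: "v \<bullet> (M x *v v) \<le> p_up * (norm v)\<^sup>2"
  using upper_bound[of x] by (simp add: loewner_le_def mat_vector_mult power2_norm_eq_inner)

lemma inner_M_commute: "v \<bullet> (M x *v w) = (M x *v v) \<bullet> w"
  by (metis dot_lmul_matrix symmetric_M transpose_matrix_vector)

text \<open>\<open>M x\<close> is positive definite, hence has trivial kernel, and
  \<open>B x\<close> has full column rank.\<close>

lemma M_mult_B_injective:
  assumes "(M x ** B x) *v w = 0"
  shows "w = 0"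
proof -
  have "p_low * (norm (B x *v w))\<^sup>2 \<le> 0"
    using inner_M_lower[of "B x *v w" x] assms by (simp add: matrix_vector_mul_assoc)
  then have "B x *v w = 0"
    using p_low by (simp add: mult_le_0_iff)
  then show ?thesis
    using rank_B[of x] full_rank_injective[of "B x"]
    by (metis injD matrix_vector_mult_0_right)
qed

lemma damping_split:
  obtains a b where "v = a + b" "a v* (M x ** B x) = 0" "a \<bullet> b = 0"
    "(norm b)\<^sup>2 = y x v \<bullet> (damping_matrix M B x *v y x v)"
  using orthogonal_split_range[where N = "M x ** B x" and v = v] M_mult_B_injective[of x]
  unfolding diff_output_def damping_matrix_def transpose_matrix_vector by blast

text \<open>The quantity is the squared norm of a projection. This makes the injection weighted by
  the damping matrix dissipative.\<close>

lemma damping_nonneg: "0 \<le> y x v \<bullet> (damping_matrix M B x *v y x v)"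
  using damping_split[of v x] by (metis zero_le_power2)

text \<open>Split \<open>v\<close> along the range of \<open>M x ** B x\<close>:
  \<open>contraction\<close> controls the component \<open>a\<close>, while the damping term is
  exactly the penalty on \<open>b\<close>.\<close>

lemma dissipation:
  "v \<bullet> (W x *v v) - 2 * \<gamma> x * (y x v \<bullet> (damping_matrix M B x *v y x v)) \<le> - \<mu> * (norm v)\<^sup>2"
proof -
  obtain a b where v: "v = a + b" and a: "a v* (M x ** B x) = 0" and ab: "a \<bullet> b = 0"
    and b: "(norm b)\<^sup>2 = y x v \<bullet> (damping_matrix M B x *v y x v)"
    by (rule damping_split)
  have "a \<bullet> (W x *v a) \<le> - 2 * \<mu> * (norm a)\<^sup>2"
  proof (cases "a = 0")
    case False
    have "a \<bullet> (W x *v a) \<le> - lam * (a \<bullet> (M x *v a))"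
      unfolding W_def using contraction[OF False a] .
    also have "\<dots> \<le> - lam * (p_low * (norm a)\<^sup>2)"
      using inner_M_lower[of a x] lam by simp
    finally show ?thesis by (simp add: \<mu>_def mult.assoc)
  qed simp
  moreover have "(norm (W x))\<^sup>2 * (1 / \<mu> + 1) + 1 + \<mu> = 2 * \<gamma> x"
    by (simp add: \<gamma>_def)
  ultimately show ?thesis
    using quadratic_form_penalty[OF \<mu>_pos ab, of "W x"] unfolding v[symmetric] b by simp
qed

section \<open>Cancellation of the input terms along trajectories\<close>

lemma jacobian_column: "jacobian (\<lambda>z. column i (B z)) (at x) *v w = column i (frechet_derivative B (at x) w)"
proof -
  have L: "bounded_linear (column i :: real^'m^'n \<Rightarrow> real^'n)"
    by (auto intro!: linearI simp: linear_conv_bounded_linear[symmetric] column_def vec_eq_iff)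
  have "frechet_derivative (\<lambda>z. column i (B z)) (at x) = (\<lambda>w. column i (frechet_derivative B (at x) w))"
    using bounded_linear.has_derivative[OF L smooth_imp_has_derivative[OF smooth_B]]
    by (rule frechet_derivative_at[symmetric])
  then show ?thesis
    by (simp add: jacobian_mult_vector bounded_linear.smooth[OF L smooth_B])
qed

text \<open>As in \<open>jacobian_column\<close>, everything is reduced to the derivative of the
  matrix map \<open>B\<close>, the common form in which \<open>killing\<close> and
  \<open>A_matrix\<close> can be compared.\<close>

lemma jacobian_input: "jacobian (\<lambda>z. B z *v u) (at x) *v w = frechet_derivative B (at x) w *v u"
proof -
  have L: "bounded_linear (\<lambda>A :: real^'m^'n. A *v u)"
    by (rule bounded_bilinear.bounded_linear_left[OF bounded_bilinear_matrix_vector_mult])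
  have "frechet_derivative (\<lambda>z. B z *v u) (at x) = (\<lambda>w. frechet_derivative B (at x) w *v u)"
    using bounded_linear.has_derivative[OF L smooth_imp_has_derivative[OF smooth_B]]
    by (rule frechet_derivative_at[symmetric])
  then show ?thesis
    by (simp add: jacobian_mult_vector bounded_linear.smooth[OF L smooth_B])
qed

text \<open>The quadratic form of \<open>killing\<close> for column \<open>i\<close>, weighted by
  \<open>u $ i\<close> and summed over \<open>i\<close>. The result collects exactly the terms of
  the storage derivative that contain \<open>u\<close>.\<close>

lemma killing_input:
  "w \<bullet> (frechet_derivative M (at x) (B x *v u) *v w)
    + 2 * (w \<bullet> (M x *v (frechet_derivative B (at x) w *v u))) = 0"
proof -
  let ?DM = "frechet_derivative M (at x)" and ?DB = "frechet_derivative B (at x) w"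
  interpret DM: linear ?DM
    using smooth_imp_has_derivative[OF smooth_M] by (rule has_derivative_linear)
  have column: "w \<bullet> (?DM (column i (B x)) *v w) + 2 * (w \<bullet> (M x *v column i ?DB)) = 0" for i
  proof -
    let ?J = "jacobian (\<lambda>z. column i (B z)) (at x)"
    \<comment> \<open>By symmetry of \<open>M\<close>, the two Jacobian terms are transposes of each
      other and have the same quadratic form, hence the factor 2.\<close>
    have "w \<bullet> ((transpose ?J ** M x) *v w) = w \<bullet> ((M x ** ?J) *v w)"
      by (metis dot_lmul_matrix inner_M_commute inner_commute matrix_vector_mul_assoc vector_transpose_matrix)
    moreover have "w \<bullet> ((deriv_along (\<lambda>z. column i (B z)) M x + transpose ?J ** M x + M x ** ?J) *v w) = 0"
      unfolding killing by simp
    ultimately show ?thesis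
      by (simp add: deriv_along_eq_frechet_derivative smooth_M matrix_vector_mult_add_rdistrib
          inner_add_right jacobian_column matrix_vector_mul_assoc[symmetric])
  qed
  have "w \<bullet> (?DM (B x *v u) *v w) = (\<Sum>i\<in>UNIV. u $ i * (w \<bullet> (?DM (column i (B x)) *v w)))"
    by (simp add: matrix_mult_sum[of "B x" u] scalar_mult_eq_scaleR DM.sum DM.scaleR inner_sum_right
        bounded_bilinear.sum_left[OF bounded_bilinear_matrix_vector_mult]
        bounded_bilinear.scaleR_left[OF bounded_bilinear_matrix_vector_mult])
  moreover have "w \<bullet> (M x *v (?DB *v u)) = (\<Sum>i\<in>UNIV. u $ i * (w \<bullet> (M x *v column i ?DB)))"
    by (simp add: matrix_mult_sum[of ?DB u] scalar_mult_eq_scaleR inner_sum_right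
        bounded_bilinear.sum_right[OF bounded_bilinear_matrix_vector_mult]
        bounded_bilinear.scaleR_right[OF bounded_bilinear_matrix_vector_mult])
  ultimately have "w \<bullet> (?DM (B x *v u) *v w) + 2 * (w \<bullet> (M x *v (?DB *v u))) =
      (\<Sum>i\<in>UNIV. u $ i * (w \<bullet> (?DM (column i (B x)) *v w) + 2 * (w \<bullet> (M x *v column i ?DB))))"
    by (simp add: sum.distrib[symmetric] sum_distrib_left algebra_simps)
  then show ?thesis
    by (simp add: column)
qed

text \<open>Product and chain rule for twice the storage function; symmetry of \<open>M\<close>
  merges the two occurrences of \<open>?dx'\<close>. The set \<open>S\<close> is arbitrary so that
  both bounded intervals for passivity and half-lines for stability are covered.\<close>

lemma storage_derivative:
  assumes x: "(x has_vector_derivative f (x t) + B (x t) *v u) (at t within S)"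
    and dx: "(dx has_vector_derivative diff_dynamics f B (x t) u (dx t) du) (at t within S)"
  shows "((\<lambda>s. dx s \<bullet> (M (x s) *v dx s)) has_real_derivative
    dx t \<bullet> (W (x t) *v dx t) + 2 * (y (x t) (dx t) \<bullet> du)) (at t within S)"
proof -
  let ?DM = "frechet_derivative M (at (x t))" and ?DB = "frechet_derivative B (at (x t))"
  let ?x' = "f (x t) + B (x t) *v u" and ?dx' = "diff_dynamics f B (x t) u (dx t) du"
  interpret DM: linear ?DM
    using smooth_imp_has_derivative[OF smooth_M] by (rule has_derivative_linear)
  have "((\<lambda>s. M (x s)) has_vector_derivative ?DM ?x') (at t within S)"
    using vector_derivative_diff_chain_within[OF x has_derivative_at_withinI[OF smooth_imp_has_derivative[OF smooth_M]]]
    by (simp add: o_def)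
  from bounded_bilinear.has_vector_derivative[OF bounded_bilinear_matrix_vector_mult this dx]
  have "((\<lambda>s. M (x s) *v dx s) has_vector_derivative M (x t) *v ?dx' + ?DM ?x' *v dx t) (at t within S)" .
  from bounded_bilinear.has_vector_derivative[OF bounded_bilinear_inner dx this]
  have "((\<lambda>s. dx s \<bullet> (M (x s) *v dx s)) has_vector_derivative
      dx t \<bullet> (M (x t) *v ?dx' + ?DM ?x' *v dx t) + ?dx' \<bullet> (M (x t) *v dx t)) (at t within S)" .
  moreover have "?dx' \<bullet> (M (x t) *v dx t) = dx t \<bullet> (M (x t) *v ?dx')"
    by (metis inner_M_commute inner_commute)
  ultimately have "((\<lambda>s. dx s \<bullet> (M (x s) *v dx s)) has_real_derivative
      dx t \<bullet> (?DM ?x' *v dx t) + 2 * (dx t \<bullet> (M (x t) *v ?dx'))) (at t within S)"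
    by (simp add: has_real_derivative_iff_has_vector_derivative inner_add_right algebra_simps)
  moreover have "?dx' = jacobian f (at (x t)) *v dx t + ?DB (dx t) *v u + B (x t) *v du"
    by (simp add: diff_dynamics_def A_matrix_def matrix_vector_mult_add_rdistrib jacobian_input)
  moreover have "dx t \<bullet> (M (x t) *v (B (x t) *v du)) = y (x t) (dx t) \<bullet> du"
    by (simp add: diff_output_def dot_lmul_matrix matrix_vector_mul_assoc)
  moreover have "dx t \<bullet> (W (x t) *v dx t) =
      dx t \<bullet> (?DM (f (x t)) *v dx t) + 2 * (dx t \<bullet> (M (x t) *v (jacobian f (at (x t)) *v dx t)))"
    by (simp add: W_def deriv_along_eq_frechet_derivative smooth_M matrix_vector_mult_add_rdistrib
        inner_add_right scaleR_matrix_vector_assoc[symmetric] matrix_vector_mul_assoc[symmetric])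
  ultimately show ?thesis
    using killing_input[of "dx t" "x t" u]
    by (simp add: DM.add matrix_vector_mult_add_rdistrib matrix_vector_right_distrib inner_add_right
        algebra_simps)
qed

text \<open>The term \<open>- \<mu> * (norm (dx t))\<^sup>2\<close> is the margin that yields exponential decay for every
  dissipative choice of \<open>dv\<close>, with or without the damping matrix.\<close>

lemma storage_dissipation:
  assumes "(x has_vector_derivative f (x t) + B (x t) *v u) (at t within S)"
    and "(dx has_vector_derivative
      diff_dynamics f B (x t) u (dx t) (diff_feedback \<gamma> M B (x t) (dx t) dv)) (at t within S)"
  obtains d where "((\<lambda>s. dx s \<bullet> (M (x s) *v dx s)) has_real_derivative d) (at t within S)"
    "d \<le> - \<mu> * (norm (dx t))\<^sup>2 + 2 * (dv \<bullet> y (x t) (dx t))"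
proof
  show "((\<lambda>s. dx s \<bullet> (M (x s) *v dx s)) has_real_derivative
      dx t \<bullet> (W (x t) *v dx t) + 2 * (y (x t) (dx t) \<bullet> diff_feedback \<gamma> M B (x t) (dx t) dv)) (at t within S)"
    using assms by (rule storage_derivative)
  show "dx t \<bullet> (W (x t) *v dx t) + 2 * (y (x t) (dx t) \<bullet> diff_feedback \<gamma> M B (x t) (dx t) dv)
      \<le> - \<mu> * (norm (dx t))\<^sup>2 + 2 * (dv \<bullet> y (x t) (dx t))"
    using dissipation[of "dx t" "x t"]
    by (simp add: diff_feedback_def inner_diff_right inner_add_right inner_commute[of dv])
qed

section \<open>Passivity and stability of the closed loop\<close>

lemma feedback_passive:
  "differentially_passive_with_storage (\<lambda>x dx. 1 / 2 * (dx \<bullet> (M x *v dx))) f B (diff_feedback \<gamma> M B) y"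
  unfolding differentially_passive_with_storage_def
proof (intro conjI allI impI ballI)
  fix x v :: "real^'n"
  have "0 \<le> p_low * (norm v)\<^sup>2"
    using p_low by simp
  then show "0 \<le> 1 / 2 * (v \<bullet> (M x *v v))"
    using inner_M_lower[of v x] by simp
next
  fix T :: real and x u dx dv t
  assume "system_solution f B u x {0..<T}" "t \<in> {0..<T}"
    and "\<forall>t\<in>{0..<T}. (dx has_vector_derivative
      diff_dynamics f B (x t) (u t) (dx t) (diff_feedback \<gamma> M B (x t) (dx t) (dv t))) (at t within {0..<T})"
  then obtain d where
    "((\<lambda>s. dx s \<bullet> (M (x s) *v dx s)) has_real_derivative d) (at t within {0..<T})"
    and le: "d \<le> - \<mu> * (norm (dx t))\<^sup>2 + 2 * (dv t \<bullet> y (x t) (dx t))"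
    unfolding system_solution_def using storage_dissipation by blast
  then have "((\<lambda>s. 1 / 2 * (dx s \<bullet> (M (x s) *v dx s))) has_real_derivative 1 / 2 * d) (at t within {0..<T})"
    by (intro DERIV_cmult)
  \<comment> \<open>Passivity only needs the sign of the margin, which is dropped here.\<close>
  moreover have "0 \<le> \<mu> * (norm (dx t))\<^sup>2"
    using \<mu>_pos by simp
  then have "1 / 2 * d \<le> dv t \<bullet> y (x t) (dx t)"
    using le by simp
  ultimately show "\<exists>d. ((\<lambda>s. 1 / 2 * (dx s \<bullet> (M (x s) *v dx s))) has_real_derivative d) (at t within {0..<T}) \<and>
      d \<le> dv t \<bullet> y (x t) (dx t)"
    by blast
qed

text \<open>\<open>D\<close> is any injection that extracts energy through the output and vanishes
  at zero, so both damping laws are instances and each even yields exponential decay.\<close>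

lemma stable:
  fixes D :: "real \<Rightarrow> real^'n \<Rightarrow> real^'m"
  assumes x: "system_solution f B u x {0..}"
    and D0: "\<And>t. D t 0 = 0"
    and D: "\<And>t v. D t v \<bullet> y (x t) v \<le> 0"
  defines "F \<equiv> \<lambda>t dx. diff_dynamics f B (x t) (u t) dx (diff_feedback \<gamma> M B (x t) dx (D t dx))"
  shows "origin_asymptotically_stable F" "origin_exponentially_stable F"
proof -
  \<comment> \<open>The upper bound on \<open>M\<close> turns the margin
    \<open>\<mu> * (norm z)\<^sup>2\<close> into at least \<open>\<alpha>\<close> times the value of
    the quadratic form.\<close>
  define \<alpha> where "\<alpha> = \<mu> / p_up"
  have F0: "F t 0 = 0" for t
    by (simp add: F_def D0 diff_dynamics_def diff_feedback_def diff_output_def)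
  \<comment> \<open>The quadratic form decays at rate \<open>\<alpha>\<close>; the square root
    halves the rate, and passing between form and norm costs the condition ratio
    \<open>p_up / p_low\<close> under the root.\<close>
  have "norm (z t) \<le> sqrt (p_up / p_low) * norm (z t0) * exp (- (\<alpha> / 2) * (t - t0))"
    if "t0 \<ge> 0" and z: "solution_from F t0 z" and "t \<ge> t0" for t0 z t
  proof -
    let ?V = "\<lambda>s. z s \<bullet> (M (x s) *v z s)"
    have "\<exists>d. (?V has_real_derivative d) (at s within {t0..}) \<and> d \<le> - \<alpha> * ?V s" if "s \<ge> t0" for s
    proof -
      have "(x has_vector_derivative f (x s) + B (x s) *v u s) (at s within {t0..})"
        using x \<open>t0 \<ge> 0\<close> that unfolding system_solution_def
        by (auto intro: has_vector_derivative_within_subset)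
      moreover have "(z has_vector_derivative diff_dynamics f B (x s) (u s) (z s)
          (diff_feedback \<gamma> M B (x s) (z s) (D s (z s)))) (at s within {t0..})"
        using z that unfolding solution_from_def F_def by blast
      ultimately obtain d where "(?V has_real_derivative d) (at s within {t0..})"
        and d: "d \<le> - \<mu> * (norm (z s))\<^sup>2 + 2 * (D s (z s) \<bullet> y (x s) (z s))"
        using storage_dissipation by blast
      moreover have "\<alpha> * ?V s \<le> \<alpha> * (p_up * (norm (z s))\<^sup>2)"
        using inner_M_upper[of "z s" "x s"] \<mu>_pos p_up by (intro mult_left_mono) (simp_all add: \<alpha>_def)
      then have "\<alpha> * ?V s \<le> \<mu> * (norm (z s))\<^sup>2"
        using p_up by (simp add: \<alpha>_def)
      ultimately show ?thesis
        using D[of s "z s"] by (intro exI[of _ d]) simp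
    qed
    then have V: "?V t \<le> ?V t0 * exp (- \<alpha> * (t - t0))"
      using \<open>t \<ge> t0\<close> by (rule exponential_decay)
    have "p_low * (norm (z t))\<^sup>2 \<le> ?V t"
      by (rule inner_M_lower)
    also note V
    also have "?V t0 * exp (- \<alpha> * (t - t0)) \<le> p_up * (norm (z t0))\<^sup>2 * exp (- \<alpha> * (t - t0))"
      by (intro mult_right_mono inner_M_upper) simp
    also have "exp (- \<alpha> * (t - t0)) = (exp (- (\<alpha> / 2) * (t - t0)))\<^sup>2"
      by (simp add: power2_eq_square exp_add[symmetric] field_simps)
    finally have "(norm (z t))\<^sup>2 \<le> p_up / p_low * (norm (z t0))\<^sup>2 * (exp (- (\<alpha> / 2) * (t - t0)))\<^sup>2"
      using p_low by (simp add: field_simps)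
    also have "\<dots> = (sqrt (p_up / p_low) * norm (z t0) * exp (- (\<alpha> / 2) * (t - t0)))\<^sup>2"
      using p_low p_up by (simp add: power_mult_distrib)
    finally show ?thesis
      using p_low p_up by (rule_tac power2_le_imp_le) simp_all
  qed
  moreover have "sqrt (p_up / p_low) > 0" "\<alpha> / 2 > 0"
    using p_low p_up \<mu>_pos by (simp_all add: \<alpha>_def)
  ultimately show "origin_asymptotically_stable F" "origin_exponentially_stable F"
    using stable_of_exponential_bound[of F "sqrt (p_up / p_low)" "\<alpha> / 2"] F0 by blast+
qed

end

theorem proposition4:
  fixes f :: "real^'n::finite \<Rightarrow> real^'n"
    and B :: "real^'n \<Rightarrow> real^'m::finite^'n"
    and M :: "real^'n \<Rightarrow> real^'n^'n"
    and xd :: "real \<Rightarrow> real^'n" and ud :: "real \<Rightarrow> real^'m"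
    and p_low p_up lam :: real
  assumes "CARD('m) < CARD('n)"
    and "smooth f" and "smooth B" and "smooth M"
    and "\<And>x. rank (B x) = CARD('m)"
    and "system_solution f B ud xd {0..}"
    and "p_low > 0" and "p_up > 0" and "lam > 0"
    and "\<And>x. transpose (M x) = M x"
    and "\<And>x. mat p_low \<preceq> M x" and "\<And>x. M x \<preceq> mat p_up"
    and "\<And>x v. v \<noteq> 0 \<Longrightarrow> v v* (M x ** B x) = 0 \<Longrightarrow>
           v \<bullet> ((deriv_along f M x + 2 *\<^sub>R (M x ** jacobian f (at x))) *v v) \<le> - lam * (v \<bullet> (M x *v v))"
    and "\<And>x i. deriv_along (\<lambda>z. column i (B z)) M x
           + transpose (jacobian (\<lambda>z. column i (B z)) (at x)) ** M x
           + M x ** jacobian (\<lambda>z. column i (B z)) (at x) = 0"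
  shows "\<exists>\<gamma> :: real^'n \<Rightarrow> real. smooth \<gamma> \<and> (\<forall>x. 0 \<le> \<gamma> x) \<and>
    differentially_passive_with_storage (\<lambda>x dx. 1 / 2 * (dx \<bullet> (M x *v dx)))
      f B (diff_feedback \<gamma> M B) (diff_output M B) \<and>
    (\<forall>\<gamma>0>0. \<forall>x u. system_solution f B u x {0..} \<longrightarrow>
      origin_asymptotically_stable
        (\<lambda>t dx. diff_dynamics f B (x t) (u t) dx
           (diff_feedback \<gamma> M B (x t) dx (- (\<gamma>0 *\<^sub>R diff_output M B (x t) dx)))) \<and>
      origin_exponentially_stable
        (\<lambda>t dx. diff_dynamics f B (x t) (u t) dx
           (diff_feedback \<gamma> M B (x t) dx
              (- (\<gamma>0 *\<^sub>R (damping_matrix M B (x t) *v diff_output M B (x t) dx))))))"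
proof -
  interpret control_contraction_metric f B M p_low p_up lam
    using assms(2-5,7-14) by unfold_locales
  have "origin_asymptotically_stable
        (\<lambda>t dx. diff_dynamics f B (x t) (u t) dx
           (diff_feedback \<gamma> M B (x t) dx (- (\<gamma>0 *\<^sub>R diff_output M B (x t) dx)))) \<and>
      origin_exponentially_stable
        (\<lambda>t dx. diff_dynamics f B (x t) (u t) dx
           (diff_feedback \<gamma> M B (x t) dx
              (- (\<gamma>0 *\<^sub>R (damping_matrix M B (x t) *v diff_output M B (x t) dx)))))"
    if "\<gamma>0 > 0" "system_solution f B u x {0..}" for \<gamma>0 :: real and x u
  proof
    have zero: "diff_output M B z 0 = 0" for z
      by (simp add: diff_output_def)
    show "origin_asymptotically_stable
        (\<lambda>t dx. diff_dynamics f B (x t) (u t) dx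
           (diff_feedback \<gamma> M B (x t) dx (- (\<gamma>0 *\<^sub>R diff_output M B (x t) dx))))"
      \<comment> \<open>Dissipativity reduces to \<open>y \<bullet> y \<ge> 0\<close>.\<close>
      using that by (intro stable(1)) (simp_all add: zero)
    show "origin_exponentially_stable
        (\<lambda>t dx. diff_dynamics f B (x t) (u t) dx
           (diff_feedback \<gamma> M B (x t) dx
              (- (\<gamma>0 *\<^sub>R (damping_matrix M B (x t) *v diff_output M B (x t) dx)))))"
      \<comment> \<open>Here dissipativity is the nonnegativity of the squared projection norm,
        scaled by \<open>\<gamma>0\<close>.\<close>
      using that damping_nonneg by (intro stable(2)) (simp_all add: zero inner_commute)
  qed
  then show ?thesis
    using smooth_\<gamma> \<gamma>_nonneg feedback_passive by blast
qed

end
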